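(* Let $\mathfrak{G}$ be an étale groupoid with compact totally disconnected metrizable unit space $\mathfrak{G}^{(0)}$, let $\Bbbk$ be a field, and let $\mathcal{S}$ be a finite set of open compact $\mathfrak{G}$-bisections generating $\mathfrak{G}$. If $\mathcal{S}$ is expansive, then the set $\{1_S : S\in\mathcal{S}\cup\mathcal{S}^{-1}\}$ generates the (unital) algebra $\Bbbk[\mathfrak{G}]$.
   Context: A groupoid $\mathfrak{G}$ is (the set of morphisms of) a small category of isomorphisms; $\mathfrak{G}^{(0)}$ is its set of units, $\mathsf{o}(g)=g^{-1}g$ the origin and $\mathsf{t}(g)=gg^{-1}$ the target of $g$; $g_1g_2$ is defined iff $\mathsf{t}(g_2)=\mathsf{o}(g_1)$; $\mathfrak{G}_x=\{g:\mathsf{o}(g)=x\}$. A topological groupoid has continuous multiplication and inversion and need not be Hausdorff. A $\mathfrak{G}$-bisection is a subset $F$ such that $\mathsf{o}:F\to\mathsf{o}(F)$ and $\mathsf{t}:F\to\mathsf{t}(F)$ are homeomorphisms. $\mathfrak{G}$ is étale if open bisections form a basis of the topology. Compact sets need not be closed or Hausdorff. $\mathcal{S}$ generates $\mathfrak{G}$ if, with $S_0=\bigcup\mathcal{S}$, $\mathfrak{G}=\bigcup_{n\ge 0}(S_0\cup S_0^{-1})^n$, where the $0$-th power is $\mathfrak{G}^{(0)}$. $\mathcal{S}^{-1}=\{F^{-1}:F\in\mathcal{S}\}$. $\mathcal{S}^n$ is the set of all products $S_1S_2\cdots S_n$ (products of subsets of $\mathfrak{G}$) of elements of $\mathcal{S}$.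 For $x\in\mathfrak{G}^{(0)}$ and $n\ge 1$ put \[A_{x,n}=\bigcap_{F\in\mathcal{S}^n,\ x\in\mathsf{o}(F)}\mathsf{o}(F)\ \setminus\bigcup_{F\in\mathcal{S}^n,\ x\notin\mathsf{o}(F)}\mathsf{o}(F)\] (an empty intersection is $\mathfrak{G}^{(0)}$). $\mathcal{S}$ is expansive if for any two different points $x,y\in\mathfrak{G}^{(0)}$ there exists $n$ such that $A_{x,n}$ and $A_{y,n}$ are disjoint. $\Bbbk[\mathfrak{G}]$ is the $\Bbbk$-algebra generated by the characteristic functions $1_F$ of open compact $\mathfrak{G}$-bisections with respect to convolution $(f_1*f_2)(g)=\sum_{h\in\mathfrak{G}_{\mathsf{o}(g)}}f_1(gh^{-1})f_2(h)$; its unit is $1_{\mathfrak{G}^{(0)}}$. Generation is understood in the sense of unital algebras.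
   Formalization: "Étale" is taken in the standard sense that the origin map is also open (origin and target are local homeomorphisms); with only a basis of open bisections, whose images need not be open, the claim fails. *)

theory Defs
  imports "HOL-Analysis.Analysis"
begin

text \<open>The set of morphisms is the carrier of the topology; multiplication and inversion are total
  functions whose values matter only on composable pairs of morphisms and on morphisms.
  Arrows compose from right to left.\<close>

record 'a tgroupoid =
  gtop :: "'a topology"
  gmul :: "'a \<Rightarrow> 'a \<Rightarrow> 'a"
  ginv :: "'a \<Rightarrow> 'a"

definition arrows :: "'a tgroupoid \<Rightarrow> 'a set"
  where "arrows G = topspace (gtop G)"

definition orig :: "'a tgroupoid \<Rightarrow> 'a \<Rightarrow> 'a"
  where "orig G g = gmul G (ginv G g) g"

definition targ :: "'a tgroupoid \<Rightarrow> 'a \<Rightarrow> 'a"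
  where "targ G g = gmul G g (ginv G g)"

definition units :: "'a tgroupoid \<Rightarrow> 'a set"
  where "units G = orig G ` arrows G"

definition composable :: "'a tgroupoid \<Rightarrow> ('a \<times> 'a) set"
  where "composable G = {(g, h). g \<in> arrows G \<and> h \<in> arrows G \<and> targ G h = orig G g}"

definition unit_space :: "'a tgroupoid \<Rightarrow> 'a topology"
  where "unit_space G = subtopology (gtop G) (units G)"

locale groupoid =
  fixes G :: "'a tgroupoid"
  assumes inv_closed: "g \<in> arrows G \<Longrightarrow> ginv G g \<in> arrows G"
    and orig_inv: "g \<in> arrows G \<Longrightarrow> orig G (ginv G g) = targ G g"
    and targ_inv: "g \<in> arrows G \<Longrightarrow> targ G (ginv G g) = orig G g"
    and mul_closed: "(g, h) \<in> composable G \<Longrightarrow> gmul G g h \<in> arrows G"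
    and orig_mul: "(g, h) \<in> composable G \<Longrightarrow> orig G (gmul G g h) = orig G h"
    and targ_mul: "(g, h) \<in> composable G \<Longrightarrow> targ G (gmul G g h) = targ G g"
    and mul_assoc: "\<lbrakk>(g, h) \<in> composable G; (h, k) \<in> composable G\<rbrakk>
      \<Longrightarrow> gmul G (gmul G g h) k = gmul G g (gmul G h k)"
    and orig_neutral: "g \<in> arrows G \<Longrightarrow> gmul G g (orig G g) = g"
    and targ_neutral: "g \<in> arrows G \<Longrightarrow> gmul G (targ G g) g = g"

locale topological_groupoid = groupoid +
  assumes continuous_inv: "continuous_map (gtop G) (gtop G) (ginv G)"
    and continuous_mul: "continuous_map (subtopology (prod_topology (gtop G) (gtop G)) (composable G))
      (gtop G) (\<lambda>(g, h). gmul G g h)"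

definition bisection :: "'a tgroupoid \<Rightarrow> 'a set \<Rightarrow> bool"
  where "bisection G F \<longleftrightarrow> F \<subseteq> arrows G \<and>
    homeomorphic_map (subtopology (gtop G) F) (subtopology (gtop G) (orig G ` F)) (orig G) \<and>
    homeomorphic_map (subtopology (gtop G) F) (subtopology (gtop G) (targ G ` F)) (targ G)"

text \<open>Openness of the origin map is part of the usual notion of an etale groupoid (origin and target
  are local homeomorphisms). It does not follow from the existence of a basis of open bisections,
  since a bisection is only required to be homeomorphic to its images, which need not be open:
  adjoin to a space, regarded as a groupoid of units, an isolated involution at a non-isolated
  point. Openness of the target map follows by inversion.\<close>

locale etale_groupoid = topological_groupoid +
  assumes bisection_basis: "\<lbrakk>openin (gtop G) U; g \<in> U\<rbrakk>
      \<Longrightarrow> \<exists>F. openin (gtop G) F \<and> bisection G F \<and> g \<in> F \<and> F \<subseteq> U"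
    and open_orig: "open_map (gtop G) (unit_space G) (orig G)"

definition totally_disconnected_space :: "'b topology \<Rightarrow> bool"
  where "totally_disconnected_space X \<longleftrightarrow> (\<forall>C. connectedin X C \<longrightarrow> (\<exists>a. C \<subseteq> {a}))"

definition open_compact_bisection :: "'a tgroupoid \<Rightarrow> 'a set \<Rightarrow> bool"
  where "open_compact_bisection G F \<longleftrightarrow>
    openin (gtop G) F \<and> compactin (gtop G) F \<and> bisection G F"

definition set_mul :: "'a tgroupoid \<Rightarrow> 'a set \<Rightarrow> 'a set \<Rightarrow> 'a set"
  where "set_mul G A B = {gmul G g h | g h. g \<in> A \<and> h \<in> B \<and> (g, h) \<in> composable G}"

primrec set_power :: "'a tgroupoid \<Rightarrow> 'a set \<Rightarrow> nat \<Rightarrow> 'a set"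
  where "set_power G A 0 = units G"
  | "set_power G A (Suc n) = set_mul G A (set_power G A n)"

definition generates :: "'a tgroupoid \<Rightarrow> 'a set set \<Rightarrow> bool"
  where "generates G S \<longleftrightarrow> arrows G = (\<Union>n. set_power G (\<Union>S \<union> ginv G ` \<Union>S) n)"

text \<open>The set of all products of \<open>n\<close> members of \<open>S\<close>; the set of units is neutral for the product of
  sets of morphisms.\<close>

primrec family_power :: "'a tgroupoid \<Rightarrow> 'a set set \<Rightarrow> nat \<Rightarrow> 'a set set"
  where "family_power G S 0 = {units G}"
  | "family_power G S (Suc n) = {set_mul G A B | A B. A \<in> S \<and> B \<in> family_power G S n}"

definition itinerary_set :: "'a tgroupoid \<Rightarrow> 'a set set \<Rightarrow> 'a \<Rightarrow> nat \<Rightarrow> 'a set"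
  where "itinerary_set G S x n =
    (units G \<inter> \<Inter>{orig G ` F | F. F \<in> family_power G S n \<and> x \<in> orig G ` F})
    - \<Union>{orig G ` F | F. F \<in> family_power G S n \<and> x \<notin> orig G ` F}"

definition expansive :: "'a tgroupoid \<Rightarrow> 'a set set \<Rightarrow> bool"
  where "expansive G S \<longleftrightarrow> (\<forall>x \<in> units G. \<forall>y \<in> units G. x \<noteq> y \<longrightarrow>
    (\<exists>n\<ge>1. itinerary_set G S x n \<inter> itinerary_set G S y n = {}))"

text \<open>Functions on the groupoid are extended by zero off the set of morphisms. The sum ranges over
  the nonzero terms only, which are finitely many for all functions in the groupoid algebra.\<close>

definition convolution :: "'a tgroupoid \<Rightarrow> ('a \<Rightarrow> 'k::field) \<Rightarrow> ('a \<Rightarrow> 'k) \<Rightarrow> 'a \<Rightarrow> 'k"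
  where "convolution G f1 f2 g =
    (if g \<in> arrows G
     then \<Sum>h | h \<in> arrows G \<and> orig G h = orig G g \<and> f1 (gmul G g (ginv G h)) * f2 h \<noteq> 0.
            f1 (gmul G g (ginv G h)) * f2 h
     else 0)"

inductive_set generated_algebra :: "'a tgroupoid \<Rightarrow> ('a \<Rightarrow> 'k::field) set \<Rightarrow> ('a \<Rightarrow> 'k) set"
  for G :: "'a tgroupoid" and A :: "('a \<Rightarrow> 'k) set"
  where
    generator: "f \<in> A \<Longrightarrow> f \<in> generated_algebra G A"
  | zero: "(\<lambda>_. 0) \<in> generated_algebra G A"
  | add: "\<lbrakk>f1 \<in> generated_algebra G A; f2 \<in> generated_algebra G A\<rbrakk>
      \<Longrightarrow> (\<lambda>g. f1 g + f2 g) \<in> generated_algebra G A"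
  | scale: "f \<in> generated_algebra G A \<Longrightarrow> (\<lambda>g. c * f g) \<in> generated_algebra G A"
  | conv: "\<lbrakk>f1 \<in> generated_algebra G A; f2 \<in> generated_algebra G A\<rbrakk>
      \<Longrightarrow> convolution G f1 f2 \<in> generated_algebra G A"

definition generated_unital_algebra :: "'a tgroupoid \<Rightarrow> ('a \<Rightarrow> 'k::field) set \<Rightarrow> ('a \<Rightarrow> 'k) set"
  where "generated_unital_algebra G A = generated_algebra G (insert (indicator (units G)) A)"

definition groupoid_algebra :: "'a tgroupoid \<Rightarrow> ('a \<Rightarrow> 'k::field) set"
  where "groupoid_algebra G = generated_algebra G {indicator F | F. open_compact_bisection G F}"

end

theory Submission
  imports Defs
begin

text \<open>
  The algebra \<open>A\<close> generated by the indicators of \<open>S\<close> and of the inverses contains the indicator of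
  every product of members of \<open>S\<close> and their inverses, because the indicators of two bisections
  convolve to the indicator of their product set. As \<open>F\<^sup>-\<^sup>1 F = o(F)\<close> for a bisection \<open>F\<close>, it
  also contains the indicators of the domains \<open>o(F)\<close> of all products \<open>F\<close>. On sets of units the
  convolution is the pointwise product, so the clopen sets of units with indicator in \<open>A\<close> form a
  Boolean algebra, to which every itinerary set belongs since \<open>S\<close> is finite. Expansivity says
  that these sets separate points; by compactness the Boolean algebra is then a basis of the topology
  of the unit space (\<open>expansive_clopen_idempotents_basis\<close>).

  Now let \<open>F\<close> be any open compact bisection and \<open>g\<close> an arrow in it. Since \<open>S\<close> generates the
  groupoid, \<open>g\<close> lies in some product \<open>P\<close> of members of \<open>S\<close> and their inverses. The open
  bisections \<open>F\<close> and \<open>P\<close> agree above the open set \<open>o(F \<inter> P)\<close>, hence above a member \<open>W\<close> of the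
  Boolean algebra that contains \<open>o(g)\<close>. So the indicator of \<open>F W = P W\<close> is \<open>1\<^sub>P * 1\<^sub>W\<close>, an
  element of \<open>A\<close>. Finitely many such \<open>W\<close> cover the compact set \<open>o(F)\<close>, and inclusion-exclusion puts the
  pieces together (\<open>indicator_in_generated_algebra\<close>).

  The topological input is that open compact bisections are closed under products and inverses, and
  that their domains are clopen in the unit space. Products and domains are open because the origin
  map is; products are compact and domains are closed because the unit space is Hausdorff.
\<close>

section \<open>Algebra in a groupoid\<close>

context groupoid
begin

lemma composable_iff:
  "(g, h) \<in> composable G \<longleftrightarrow> g \<in> arrows G \<and> h \<in> arrows G \<and> targ G h = orig G g"
  by (auto simp: composable_def)

lemma composable_inv_left: "g \<in> arrows G \<Longrightarrow> (ginv G g, g) \<in> composable G"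
  by (simp add: composable_iff inv_closed orig_inv)

lemma composable_inv_right: "g \<in> arrows G \<Longrightarrow> (g, ginv G g) \<in> composable G"
  by (simp add: composable_iff inv_closed targ_inv)

lemma orig_closed: "g \<in> arrows G \<Longrightarrow> orig G g \<in> arrows G"
  using mul_closed[OF composable_inv_left] by (simp add: orig_def)

lemma orig_in_units: "g \<in> arrows G \<Longrightarrow> orig G g \<in> units G"
  by (simp add: units_def)

lemma units_subset_arrows: "units G \<subseteq> arrows G"
  by (auto simp: units_def orig_closed)

lemma orig_unit: "x \<in> units G \<Longrightarrow> orig G x = x"
  using orig_mul[OF composable_inv_left] by (auto simp: units_def simp flip: orig_def)

lemma targ_unit: "x \<in> units G \<Longrightarrow> targ G x = x"
  using targ_mul[OF composable_inv_left] by (auto simp: units_def targ_inv simp flip: orig_def)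

lemma inv_inv:
  assumes "g \<in> arrows G"
  shows "ginv G (ginv G g) = g"
proof -
  let ?k = "ginv G (ginv G g)"
  have k: "?k \<in> arrows G" "orig G ?k = orig G g"
    using assms by (simp_all add: inv_closed orig_inv targ_inv)
  have "?k = gmul G ?k (gmul G (ginv G g) g)"
    using orig_neutral[OF k(1)] k(2) by (simp add: orig_def)
  also have "\<dots> = gmul G (gmul G ?k (ginv G g)) g"
    using assms by (simp add: mul_assoc composable_inv_left inv_closed)
  also have "\<dots> = gmul G (targ G g) g"
    using orig_inv[OF assms] by (simp add: orig_def)
  finally show ?thesis using targ_neutral[OF assms] by simp
qed

lemma inv_unit:
  assumes "x \<in> units G"
  shows "ginv G x = x"
proof -
  have x: "x \<in> arrows G" using assms units_subset_arrows by auto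
  have "ginv G x = gmul G (ginv G x) x"
    using orig_neutral[OF inv_closed[OF x]] assms x by (simp add: orig_inv targ_unit)
  also have "\<dots> = x" using orig_unit[OF assms] by (simp add: orig_def)
  finally show ?thesis .
qed

lemma mul_inv_cancel_right:
  assumes "(g, h) \<in> composable G"
  shows "gmul G (gmul G g h) (ginv G h) = g"
proof -
  have "gmul G (gmul G g h) (ginv G h) = gmul G g (targ G h)"
    using mul_assoc[OF assms composable_inv_right] assms by (simp add: composable_iff targ_def)
  then show ?thesis using assms orig_neutral by (auto simp: composable_iff)
qed

lemma inv_mul_cancel_right:
  assumes "g \<in> arrows G" "h \<in> arrows G" "orig G h = orig G g"
  shows "gmul G (gmul G g (ginv G h)) h = g"
    and "(gmul G g (ginv G h), h) \<in> composable G"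
proof -
  have c: "(g, ginv G h) \<in> composable G"
    using assms by (simp add: composable_iff inv_closed targ_inv)
  show "gmul G (gmul G g (ginv G h)) h = g"
    using mul_inv_cancel_right[OF c] inv_inv assms by simp
  show "(gmul G g (ginv G h), h) \<in> composable G"
    using assms mul_closed[OF c] orig_mul[OF c] by (simp add: composable_iff orig_inv)
qed

lemma mul_right_cancel:
  assumes "(g, h) \<in> composable G" "(g', h) \<in> composable G" "gmul G g h = gmul G g' h"
  shows "g = g'"
  using mul_inv_cancel_right assms by metis

lemma composable_inverses:
  "(g, h) \<in> composable G \<Longrightarrow> (ginv G h, ginv G g) \<in> composable G"
  by (auto simp: composable_iff inv_closed orig_inv targ_inv)

lemma inv_mul:
  assumes c: "(g, h) \<in> composable G"
  shows "ginv G (gmul G g h) = gmul G (ginv G h) (ginv G g)"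
proof -
  have gh: "g \<in> arrows G" "h \<in> arrows G" "targ G h = orig G g"
    using c by (auto simp: composable_iff)
  note c' = composable_inverses[OF c]
  have gh': "gmul G g h \<in> arrows G" by (rule mul_closed[OF c])
  have ig: "(ginv G g, gmul G g h) \<in> composable G"
    using gh gh' targ_mul[OF c] by (simp add: composable_iff inv_closed orig_inv)
  have "gmul G (gmul G (ginv G h) (ginv G g)) (gmul G g h)
      = gmul G (ginv G h) (gmul G (gmul G (ginv G g) g) h)"
    using mul_assoc[OF c' ig] mul_assoc[OF composable_inv_left c] gh by simp
  also have "\<dots> = gmul G (ginv G h) h"
    using gh targ_neutral by (metis orig_def)
  also have "\<dots> = gmul G (ginv G (gmul G g h)) (gmul G g h)"
    using orig_mul[OF c] by (simp add: orig_def)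
  finally show ?thesis
    using mul_right_cancel[of _ "gmul G g h"] composable_inv_left[OF gh']
      mul_closed[OF c'] orig_mul[OF c'] targ_mul[OF c] gh gh'
    by (metis composable_iff orig_inv)
qed

end

section \<open>Products of sets of arrows\<close>

context groupoid
begin

lemma set_mul_subset_arrows: "set_mul G E F \<subseteq> arrows G"
  by (auto simp: set_mul_def mul_closed)

lemma set_mul_iff:
  assumes "F \<subseteq> arrows G" "k \<in> arrows G"
  shows "k \<in> set_mul G E F \<longleftrightarrow> (\<exists>h\<in>F. orig G h = orig G k \<and> gmul G k (ginv G h) \<in> E)"
proof
  assume "k \<in> set_mul G E F"
  then obtain g h where "g \<in> E" "h \<in> F" "(g, h) \<in> composable G" "k = gmul G g h"
    by (auto simp: set_mul_def)
  then show "\<exists>h\<in>F. orig G h = orig G k \<and> gmul G k (ginv G h) \<in> E"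
    using orig_mul mul_inv_cancel_right by metis
next
  assume "\<exists>h\<in>F. orig G h = orig G k \<and> gmul G k (ginv G h) \<in> E"
  then obtain h where h: "h \<in> F" "orig G h = orig G k" "gmul G k (ginv G h) \<in> E"
    by blast
  then have "k = gmul G (gmul G k (ginv G h)) h" "(gmul G k (ginv G h), h) \<in> composable G"
    using inv_mul_cancel_right[of k h] assms by auto
  then show "k \<in> set_mul G E F"
    using h unfolding set_mul_def by blast
qed

lemma set_mul_units_right:
  assumes "F \<subseteq> arrows G" "W \<subseteq> units G"
  shows "set_mul G F W = {g \<in> F. orig G g \<in> W}"
proof -
  have fwd: "gmul G g w = g" "w = orig G g"
    if "g \<in> F" "w \<in> W" "(g, w) \<in> composable G" for g w
    using that assms orig_neutral targ_unit by (auto simp: composable_iff)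
  have bwd: "(g, orig G g) \<in> composable G" "gmul G g (orig G g) = g" if "g \<in> F" for g
    using that assms by (auto simp: composable_iff orig_closed orig_neutral targ_unit orig_in_units subset_iff)
  show ?thesis
  proof (intro equalityI subsetI)
    fix k assume "k \<in> set_mul G F W"
    then obtain g w where gw: "g \<in> F" "w \<in> W" "(g, w) \<in> composable G" "k = gmul G g w"
      by (auto simp: set_mul_def)
    then show "k \<in> {g \<in> F. orig G g \<in> W}"
      using fwd[OF gw(1-3)] by simp
  next
    fix k assume "k \<in> {g \<in> F. orig G g \<in> W}"
    then have "k \<in> F" "orig G k \<in> W" by simp_all
    then show "k \<in> set_mul G F W"
      using bwd[of k] unfolding set_mul_def mem_Collect_eq by metis
  qed
qed

lemma inv_image_set_mul:
  assumes "E \<subseteq> arrows G" "F \<subseteq> arrows G"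
  shows "ginv G ` set_mul G E F = set_mul G (ginv G ` F) (ginv G ` E)"
proof (intro equalityI subsetI)
  fix k assume "k \<in> ginv G ` set_mul G E F"
  then show "k \<in> set_mul G (ginv G ` F) (ginv G ` E)"
    using inv_mul composable_inverses by (fastforce simp: set_mul_def)
next
  fix k assume "k \<in> set_mul G (ginv G ` F) (ginv G ` E)"
  then obtain f e where fe: "f \<in> F" "e \<in> E" "(ginv G f, ginv G e) \<in> composable G"
      "k = gmul G (ginv G f) (ginv G e)"
    by (auto simp: set_mul_def)
  then have "(e, f) \<in> composable G"
    using composable_inverses[OF fe(3)] assms inv_inv by (metis subsetD)
  then have "gmul G e f \<in> set_mul G E F" "k = ginv G (gmul G e f)"
    using fe inv_mul by (auto simp: set_mul_def)
  then show "k \<in> ginv G ` set_mul G E F" by blast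
qed

lemma inv_image_inv_image: "F \<subseteq> arrows G \<Longrightarrow> ginv G ` ginv G ` F = F"
  unfolding image_image by (subst image_cong[OF refl, of F _ "\<lambda>g. g"]) (auto simp: inv_inv)

lemma inv_image_subset_arrows: "F \<subseteq> arrows G \<Longrightarrow> ginv G ` F \<subseteq> arrows G"
  using inv_closed by auto

lemma inv_image_units: "ginv G ` units G = units G"
  by (subst image_cong[OF refl, of "units G" _ "\<lambda>x. x"]) (simp_all add: inv_unit)

lemma orig_inv_image: "F \<subseteq> arrows G \<Longrightarrow> orig G ` ginv G ` F = targ G ` F"
  unfolding image_image by (rule image_cong) (auto simp: orig_inv)

lemma inj_on_orig_inv_image:
  "F \<subseteq> arrows G \<Longrightarrow> inj_on (targ G) F \<Longrightarrow> inj_on (orig G) (ginv G ` F)"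
  by (auto simp: inj_on_def orig_inv subset_iff)

lemma inj_on_targ_inv_image:
  "F \<subseteq> arrows G \<Longrightarrow> inj_on (orig G) F \<Longrightarrow> inj_on (targ G) (ginv G ` F)"
  by (auto simp: inj_on_def targ_inv subset_iff)

lemma inj_on_orig_set_mul:
  assumes "inj_on (orig G) E" "inj_on (orig G) F"
  shows "inj_on (orig G) (set_mul G E F)"
proof (rule inj_onI)
  fix k k' assume k: "k \<in> set_mul G E F" "k' \<in> set_mul G E F" "orig G k = orig G k'"
  then obtain e f e' f' where ef:
      "e \<in> E" "f \<in> F" "(e, f) \<in> composable G" "k = gmul G e f"
      "e' \<in> E" "f' \<in> F" "(e', f') \<in> composable G" "k' = gmul G e' f'"
    by (auto simp: set_mul_def)
  then have "f = f'"
    using k orig_mul assms(2) by (auto simp: inj_on_def)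
  moreover from this have "e = e'"
    using ef assms(1) by (auto simp: inj_on_def composable_iff)
  ultimately show "k = k'" using ef by simp
qed

lemma inj_on_targ_set_mul:
  assumes "inj_on (targ G) E" "inj_on (targ G) F"
  shows "inj_on (targ G) (set_mul G E F)"
proof (rule inj_onI)
  fix k k' assume k: "k \<in> set_mul G E F" "k' \<in> set_mul G E F" "targ G k = targ G k'"
  then obtain e f e' f' where ef:
      "e \<in> E" "f \<in> F" "(e, f) \<in> composable G" "k = gmul G e f"
      "e' \<in> E" "f' \<in> F" "(e', f') \<in> composable G" "k' = gmul G e' f'"
    by (auto simp: set_mul_def)
  then have "e = e'"
    using k targ_mul assms(1) by (auto simp: inj_on_def)
  moreover from this have "f = f'"
    using ef assms(2) by (auto simp: inj_on_def composable_iff)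
  ultimately show "k = k'" using ef by simp
qed

lemma set_mul_inv_image:
  assumes "F \<subseteq> arrows G" "inj_on (targ G) F"
  shows "set_mul G (ginv G ` F) F = orig G ` F"
proof (intro equalityI subsetI)
  fix k assume "k \<in> set_mul G (ginv G ` F) F"
  then obtain f f' where ff: "f \<in> F" "f' \<in> F" "(ginv G f, f') \<in> composable G"
      "k = gmul G (ginv G f) f'"
    by (auto simp: set_mul_def)
  then have "f = f'"
    using assms by (auto simp: composable_iff inj_on_def orig_inv subset_iff)
  then show "k \<in> orig G ` F" using ff by (auto simp: orig_def)
next
  fix k assume "k \<in> orig G ` F"
  then show "k \<in> set_mul G (ginv G ` F) F"
    using assms composable_inv_left unfolding set_mul_def orig_def by blast
qed

text \<open>In the sum that defines the convolution at \<open>k\<close> only arrows of \<open>F\<close> with the same origin as \<open>k\<close> contribute, and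
  injectivity of the origin map on \<open>F\<close> leaves at most one of them.\<close>

lemma convolution_indicator:
  assumes "F \<subseteq> arrows G" "inj_on (orig G) F"
  shows "convolution G (indicator E) (indicator F) = (indicator (set_mul G E F) :: 'a \<Rightarrow> 'k::field)"
proof
  fix k
  show "convolution G (indicator E) (indicator F) k = (indicator (set_mul G E F) k :: 'k)"
  proof (cases "k \<in> arrows G")
    case False
    then show ?thesis
      using set_mul_subset_arrows[of E F] by (auto simp: convolution_def indicator_def)
  next
    case True
    let ?f = "\<lambda>h. (indicator E (gmul G k (ginv G h)) * indicator F h :: 'k)"
    let ?H = "{h \<in> arrows G. orig G h = orig G k \<and> ?f h \<noteq> 0}"
    have H: "?H = {h \<in> F. orig G h = orig G k \<and> gmul G k (ginv G h) \<in> E}"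
      using assms by (auto simp: indicator_def)
    have conv: "convolution G (indicator E) (indicator F) k = (\<Sum>h\<in>?H. ?f h)"
      using True by (simp add: convolution_def)
    show ?thesis
    proof (cases "k \<in> set_mul G E F")
      case kin: True
      then obtain h where h: "h \<in> F" "orig G h = orig G k" "gmul G k (ginv G h) \<in> E"
        using set_mul_iff[OF assms(1) True] by blast
      then have "?H = {h}"
        unfolding H using assms(2) by (auto simp: inj_on_def)
      then show ?thesis unfolding conv using h kin by simp
    next
      case kout: False
      then have "?H = {}"
        unfolding H using set_mul_iff[OF assms(1) True] by blast
      then show ?thesis unfolding conv by (subst \<open>?H = {}\<close>) (simp add: kout)
    qed
  qed
qed

end

section \<open>Open compact bisections in an etale groupoid\<close>

context topological_groupoid
begin

lemma topspace_unit_space: "topspace (unit_space G) = units G"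
  using units_subset_arrows by (auto simp: unit_space_def arrows_def)

lemma continuous_map_gmul:
  assumes "continuous_map X (gtop G) a" "continuous_map X (gtop G) b"
    and "\<And>x. x \<in> topspace X \<Longrightarrow> (a x, b x) \<in> composable G"
  shows "continuous_map X (gtop G) (\<lambda>x. gmul G (a x) (b x))"
proof -
  have "continuous_map X (subtopology (prod_topology (gtop G) (gtop G)) (composable G))
      (\<lambda>x. (a x, b x))"
    using assms by (auto simp: continuous_map_in_subtopology continuous_map_pairedI)
  from continuous_map_compose[OF this continuous_mul] show ?thesis
    by (simp add: o_def)
qed

lemma continuous_orig: "continuous_map (gtop G) (unit_space G) (orig G)"
proof -
  have "continuous_map (gtop G) (gtop G) (\<lambda>g. gmul G (ginv G g) g)"
    by (intro continuous_map_gmul continuous_inv)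
       (auto simp: composable_inv_left arrows_def)
  then show ?thesis
    by (auto simp: unit_space_def continuous_map_in_subtopology orig_def[abs_def] units_def arrows_def)
qed

lemma continuous_targ: "continuous_map (gtop G) (unit_space G) (targ G)"
  using continuous_map_eq[OF continuous_map_compose[OF continuous_inv continuous_orig]]
  by (auto simp: orig_inv arrows_def)

lemma openin_inv_image:
  assumes "openin (gtop G) F"
  shows "openin (gtop G) (ginv G ` F)"
proof -
  have sub: "F \<subseteq> arrows G" using openin_subset[OF assms] by (simp add: arrows_def)
  have "ginv G ` F = {g \<in> topspace (gtop G). ginv G g \<in> F}"
    using sub inv_inv inv_closed by (force simp: image_iff subset_iff simp flip: arrows_def)
  then show ?thesis
    using openin_continuous_map_preimage[OF continuous_inv assms] by simp
qed

text \<open>The composable pairs are those where two continuous maps into the Hausdorff unit space agree,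
  so they form a closed set of pairs, even where the space of arrows is not Hausdorff.\<close>

lemma compactin_set_mul:
  assumes "Hausdorff_space (unit_space G)" "compactin (gtop G) E" "compactin (gtop G) F"
  shows "compactin (gtop G) (set_mul G E F)"
proof -
  let ?P = "prod_topology (gtop G) (gtop G)"
  let ?D = "{z \<in> topspace ?P. orig G (fst z) = targ G (snd z)}"
  have D: "?D = composable G"
    by (auto simp: composable_iff arrows_def)
  have "closedin ?P ?D"
    by (intro closedin_continuous_maps_eq[OF assms(1)]
        continuous_map_compose[OF continuous_map_fst continuous_orig, unfolded o_def]
        continuous_map_compose[OF continuous_map_snd continuous_targ, unfolded o_def])
  then have "compactin ?P (composable G \<inter> E \<times> F)"
    using assms D by (intro closed_Int_compactin) (auto simp: compactin_Times)
  then have "compactin (subtopology ?P (composable G)) (composable G \<inter> E \<times> F)"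
    by (auto simp: compactin_subtopology)
  from image_compactin[OF this continuous_mul]
  have "compactin (gtop G) ((\<lambda>(g, h). gmul G g h) ` (composable G \<inter> E \<times> F))" .
  also have "(\<lambda>(g, h). gmul G g h) ` (composable G \<inter> E \<times> F) = set_mul G E F"
    by (force simp: set_mul_def image_iff)
  finally show ?thesis .
qed

end

context etale_groupoid
begin

text \<open>An arrow \<open>g\<close> close to a unit \<open>x\<close> lies in an open bisection \<open>F\<close> around \<open>x\<close> together with its
  origin; as both have the same origin, injectivity on \<open>F\<close> makes \<open>g\<close> a unit.\<close>

lemma openin_units: "openin (gtop G) (units G)"
proof (subst openin_subopen, intro ballI)
  fix x assume x: "x \<in> units G"
  have "x \<in> topspace (gtop G)" using x units_subset_arrows by (auto simp: arrows_def)
  then obtain F where F: "openin (gtop G) F" "bisection G F" "x \<in> F"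
    using bisection_basis[of "topspace (gtop G)" x] by blast
  have inj: "inj_on (orig G) F"
    using F openin_subset[OF F(1)]
    by (auto simp: bisection_def homeomorphic_eq_everything_map Int_absorb1)
  let ?V = "F \<inter> {g \<in> topspace (gtop G). orig G g \<in> F}"
  have "continuous_map (gtop G) (gtop G) (orig G)"
    using continuous_orig by (simp add: unit_space_def continuous_map_in_subtopology)
  then have "openin (gtop G) ?V"
    using F by (intro openin_Int openin_continuous_map_preimage)
  moreover have "x \<in> ?V"
    using F x \<open>x \<in> topspace (gtop G)\<close> by (simp add: orig_unit)
  moreover have "?V \<subseteq> units G"
  proof
    fix g assume g: "g \<in> ?V"
    then have u: "orig G g \<in> units G" by (simp add: orig_in_units arrows_def)
    then have "orig G (orig G g) = orig G g" by (rule orig_unit)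
    then have "orig G g = g" using inj g by (auto simp: inj_on_def)
    then show "g \<in> units G" using u by simp
  qed
  ultimately show "\<exists>T. openin (gtop G) T \<and> x \<in> T \<and> T \<subseteq> units G" by blast
qed

lemma open_targ: "open_map (gtop G) (unit_space G) (targ G)"
  unfolding open_map_def
proof (intro allI impI)
  fix U assume U: "openin (gtop G) U"
  then have "U \<subseteq> arrows G" using openin_subset by (auto simp: arrows_def)
  then show "openin (unit_space G) (targ G ` U)"
    using open_orig openin_inv_image[OF U] orig_inv_image[of U] by (auto simp: open_map_def)
qed

lemma openin_unit_space_iff: "openin (unit_space G) W \<longleftrightarrow> openin (gtop G) W \<and> W \<subseteq> units G"
  by (simp add: unit_space_def openin_open_subtopology openin_units)

lemma homeomorphic_map_restrict_open_injective:
  assumes "openin (gtop G) F" "continuous_map (gtop G) (unit_space G) f"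
    "open_map (gtop G) (unit_space G) f" "inj_on f F"
  shows "homeomorphic_map (subtopology (gtop G) F) (subtopology (gtop G) (f ` F)) f"
proof -
  have sub: "F \<subseteq> topspace (gtop G)" using assms(1) by (rule openin_subset)
  have op: "openin (gtop G) (f ` U)" if "openin (gtop G) U" for U
    using assms(3) that by (simp add: open_map_def openin_unit_space_iff)
  have cont: "continuous_map (gtop G) (gtop G) f"
    using assms(2) by (simp add: unit_space_def continuous_map_in_subtopology)
  show ?thesis
  proof (rule bijective_open_imp_homeomorphic_map)
    show "continuous_map (subtopology (gtop G) F) (subtopology (gtop G) (f ` F)) f"
      using cont by (auto simp: continuous_map_in_subtopology continuous_map_from_subtopology)
    show "open_map (subtopology (gtop G) F) (subtopology (gtop G) (f ` F)) f"
      using assms(1) op by (auto simp: open_map_def openin_open_subtopology)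
    show "f ` topspace (subtopology (gtop G) F) = topspace (subtopology (gtop G) (f ` F))"
      using sub openin_subset[OF op[OF assms(1)]] by (simp add: Int_absorb1)
    show "inj_on f (topspace (subtopology (gtop G) F))"
      using assms(4) sub by (simp add: Int_absorb1)
  qed
qed

text \<open>Origin and target are open and continuous, so on an open set injectivity is all that a
  homeomorphism onto the image requires.\<close>

lemma open_compact_bisection_iff:
  "open_compact_bisection G F \<longleftrightarrow> openin (gtop G) F \<and> compactin (gtop G) F \<and>
     inj_on (orig G) F \<and> inj_on (targ G) F"
proof -
  have "bisection G F \<longleftrightarrow> inj_on (orig G) F \<and> inj_on (targ G) F" if F: "openin (gtop G) F"
  proof
    assume "bisection G F"
    then show "inj_on (orig G) F \<and> inj_on (targ G) F"
      using openin_subset[OF F]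
      by (auto simp: bisection_def homeomorphic_eq_everything_map Int_absorb1)
  next
    assume "inj_on (orig G) F \<and> inj_on (targ G) F"
    then show "bisection G F"
      using openin_subset[OF F] homeomorphic_map_restrict_open_injective[OF F]
        continuous_orig continuous_targ open_orig open_targ
      by (auto simp: bisection_def arrows_def)
  qed
  then show ?thesis by (auto simp: open_compact_bisection_def)
qed

lemma open_compact_bisection_subset: "open_compact_bisection G F \<Longrightarrow> F \<subseteq> arrows G"
  by (simp add: open_compact_bisection_def bisection_def)

text \<open>Let \<open>s\<close> invert the origin map on \<open>F\<close>. Then \<open>E F\<close> is the preimage of \<open>E\<close> under the map sending
  \<open>k\<close> to \<open>k s(o(k))\<^sup>-\<^sup>1\<close>, which is continuous on the open set of arrows with origin in \<open>o(F)\<close>.\<close>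

lemma openin_set_mul:
  assumes E: "openin (gtop G) E" and F: "openin (gtop G) F" "inj_on (orig G) F"
  shows "openin (gtop G) (set_mul G E F)"
proof -
  have sub: "F \<subseteq> arrows G" using openin_subset[OF F(1)] by (simp add: arrows_def)
  have "homeomorphic_map (subtopology (gtop G) F) (subtopology (gtop G) (orig G ` F)) (orig G)"
    by (intro homeomorphic_map_restrict_open_injective F continuous_orig open_orig)
  then obtain s where s: "homeomorphic_maps (subtopology (gtop G) F)
      (subtopology (gtop G) (orig G ` F)) (orig G) s"
    by (auto simp: homeomorphic_map_maps)
  have s_orig: "s (orig G h) = h" if "h \<in> F" for h
    using s that sub by (auto simp: homeomorphic_maps_def arrows_def)
  have s_cont: "continuous_map (subtopology (gtop G) (orig G ` F)) (gtop G) s"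
    using s by (simp add: homeomorphic_maps_def continuous_map_in_subtopology)
  let ?V = "{k \<in> topspace (gtop G). orig G k \<in> orig G ` F}"
  have V: "openin (gtop G) ?V"
    using open_orig F by (intro openin_continuous_map_preimage[OF continuous_orig]) (simp add: open_map_def)
  have o_cont: "continuous_map (subtopology (gtop G) ?V) (subtopology (gtop G) (orig G ` F)) (orig G)"
    using continuous_orig
    by (auto simp: continuous_map_in_subtopology unit_space_def continuous_map_from_subtopology)
  have so_cont: "continuous_map (subtopology (gtop G) ?V) (gtop G) (\<lambda>k. s (orig G k))"
    using continuous_map_compose[OF o_cont s_cont] by (simp add: o_def)
  have "continuous_map (subtopology (gtop G) ?V) (gtop G) (\<lambda>k. gmul G k (ginv G (s (orig G k))))"
  proof (rule continuous_map_gmul)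
    show "continuous_map (subtopology (gtop G) ?V) (gtop G) (\<lambda>k. k)"
      by (simp add: continuous_map_from_subtopology)
    show "continuous_map (subtopology (gtop G) ?V) (gtop G) (\<lambda>k. ginv G (s (orig G k)))"
      using continuous_map_compose[OF so_cont continuous_inv] by (simp add: o_def)
    fix k assume "k \<in> topspace (subtopology (gtop G) ?V)"
    then obtain h where "k \<in> arrows G" "h \<in> F" "orig G k = orig G h"
      by (auto simp: arrows_def)
    then show "(k, ginv G (s (orig G k))) \<in> composable G"
      using sub s_orig by (auto simp: composable_iff inv_closed targ_inv)
  qed
  from openin_continuous_map_preimage[OF this E]
  have "openin (gtop G) {k \<in> ?V. gmul G k (ginv G (s (orig G k))) \<in> E}"
    using V by (auto simp: openin_open_subtopology)
  also have "{k \<in> ?V. gmul G k (ginv G (s (orig G k))) \<in> E} = set_mul G E F" (is "?L = _")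
  proof (intro equalityI subsetI)
    fix k assume "k \<in> ?L"
    then show "k \<in> set_mul G E F"
      using set_mul_iff[OF sub] s_orig by (auto simp: arrows_def)
  next
    fix k assume k: "k \<in> set_mul G E F"
    then have "k \<in> arrows G" using set_mul_subset_arrows by auto
    moreover from this obtain h where "h \<in> F" "orig G h = orig G k" "gmul G k (ginv G h) \<in> E"
      using k set_mul_iff[OF sub] by blast
    moreover from this have "s (orig G k) = h" using s_orig by metis
    ultimately show "k \<in> ?L" by (auto simp: arrows_def intro: rev_image_eqI)
  qed
  finally show ?thesis .
qed

lemma open_compact_bisection_set_mul:
  assumes "Hausdorff_space (unit_space G)" "open_compact_bisection G E" "open_compact_bisection G F"
  shows "open_compact_bisection G (set_mul G E F)"
  using assms
  by (simp add: open_compact_bisection_iff openin_set_mul compactin_set_mul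
      inj_on_orig_set_mul inj_on_targ_set_mul)

lemma open_compact_bisection_inv_image:
  assumes "open_compact_bisection G F"
  shows "open_compact_bisection G (ginv G ` F)"
  using assms open_compact_bisection_subset[OF assms]
  by (simp add: open_compact_bisection_iff openin_inv_image inj_on_orig_inv_image
      inj_on_targ_inv_image image_compactin[OF _ continuous_inv])

lemma open_compact_bisection_units:
  assumes "compact_space (unit_space G)"
  shows "open_compact_bisection G (units G)"
proof -
  have "compactin (gtop G) (units G)"
    using assms units_subset_arrows
    by (simp add: unit_space_def compact_space_subtopology compactin_subspace arrows_def)
  then show ?thesis
    by (auto simp: open_compact_bisection_iff openin_units inj_on_def orig_unit targ_unit)
qed

lemma clopen_orig_image:
  assumes "Hausdorff_space (unit_space G)" "open_compact_bisection G F"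
  shows "openin (unit_space G) (orig G ` F)" "closedin (unit_space G) (orig G ` F)"
  using assms open_orig compactin_imp_closedin[OF assms(1) image_compactin[OF _ continuous_orig]]
  by (auto simp: open_compact_bisection_def open_map_def)

end

section \<open>Two compactness arguments\<close>

text \<open>For fixed \<open>x\<close>, each point \<open>y\<close> outside \<open>U\<close> has a neighbourhood \<open>W\<close> in \<open>R\<close> missed by
  some \<open>V\<close> in \<open>R\<close> around \<open>x\<close>. Finitely many of these \<open>W\<close> cover the compact complement of \<open>U\<close>, and
  the intersection of the corresponding \<open>V\<close> is a neighbourhood of \<open>x\<close> inside \<open>U\<close>.\<close>

lemma separating_open_sets_form_basis:
  assumes X: "compact_space X"
    and opn: "\<And>V. V \<in> R \<Longrightarrow> openin X V"
    and top: "topspace X \<in> R" and int: "\<And>V W. V \<in> R \<Longrightarrow> W \<in> R \<Longrightarrow> V \<inter> W \<in> R"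
    and sep: "\<And>x y. \<lbrakk>x \<in> topspace X; y \<in> topspace X; x \<noteq> y\<rbrakk>
      \<Longrightarrow> \<exists>V\<in>R. \<exists>W\<in>R. x \<in> V \<and> y \<in> W \<and> V \<inter> W = {}"
    and U: "openin X U" "x \<in> U"
  shows "\<exists>W\<in>R. x \<in> W \<and> W \<subseteq> U"
proof -
  have x: "x \<in> topspace X" using U openin_subset by auto
  have K: "compactin X (topspace X - U)"
    using X U by (intro closedin_compact_space) auto
  have "\<forall>y\<in>topspace X - U. \<exists>V W. V \<in> R \<and> W \<in> R \<and> x \<in> V \<and> y \<in> W \<and> V \<inter> W = {}"
    using sep x U by blast
  then obtain V W where VW: "\<And>y. y \<in> topspace X - U \<Longrightarrow>
      V y \<in> R \<and> W y \<in> R \<and> x \<in> V y \<and> y \<in> W y \<and> V y \<inter> W y = {}"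
    by metis
  have "\<exists>\<F>. finite \<F> \<and> \<F> \<subseteq> W ` (topspace X - U) \<and> topspace X - U \<subseteq> \<Union>\<F>"
    using VW opn by (intro compactinD[OF K]) auto
  then obtain Y where Y: "finite Y" "Y \<subseteq> topspace X - U" "topspace X - U \<subseteq> \<Union>(W ` Y)"
    by (metis finite_subset_image)
  have inR: "topspace X \<inter> \<Inter>(V ` Z) \<in> R" if "finite Z" "Z \<subseteq> Y" for Z
    using that
  proof (induction Z)
    case empty
    then show ?case using top by simp
  next
    case (insert z Z)
    then have "V z \<in> R" "topspace X \<inter> \<Inter>(V ` Z) \<in> R"
      using VW[of z] Y by auto
    from int[OF this] show ?case by (simp add: Int_left_commute)
  qed
  show ?thesis
  proof (intro bexI conjI)
    show "topspace X \<inter> \<Inter>(V ` Y) \<in> R" using inR Y by blast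
    show "x \<in> topspace X \<inter> \<Inter>(V ` Y)" using x VW Y by blast
    show "topspace X \<inter> \<Inter>(V ` Y) \<subseteq> U"
    proof
      fix z assume z: "z \<in> topspace X \<inter> \<Inter>(V ` Y)"
      show "z \<in> U"
      proof (rule ccontr)
        assume "z \<notin> U"
        then obtain y where "y \<in> Y" "z \<in> W y" using Y z by blast
        then show False using VW[of y] Y z by blast
      qed
    qed
  qed
qed

lemma compactin_mem_union_closed_cover:
  assumes K: "compactin X K"
    and "\<And>W. W \<in> T \<Longrightarrow> openin X W \<and> W \<subseteq> K"
    and "{} \<in> T" "\<And>V W. V \<in> T \<Longrightarrow> W \<in> T \<Longrightarrow> V \<union> W \<in> T"
    and "\<And>x. x \<in> K \<Longrightarrow> \<exists>W\<in>T. x \<in> W"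
  shows "K \<in> T"
proof -
  have "\<exists>\<F>. finite \<F> \<and> \<F> \<subseteq> T \<and> K \<subseteq> \<Union>\<F>"
    using assms(2,5) by (intro compactinD[OF K]) auto
  then obtain \<F> where F: "finite \<F>" "\<F> \<subseteq> T" "K \<subseteq> \<Union>\<F>"
    by blast
  have "\<Union>\<F> \<in> T"
    using F(1,2)
  proof (induction \<F>)
    case empty
    then show ?case using assms(3) by simp
  next
    case (insert W \<F>)
    then have "W \<in> T" "\<Union>\<F> \<in> T" by auto
    from assms(4)[OF this] show ?case by simp
  qed
  moreover have "\<Union>\<F> = K" using F assms(2) by blast
  ultimately show ?thesis by simp
qed

section \<open>Indicators in a generated algebra\<close>

lemma generated_algebra_diff:
  assumes "f1 \<in> generated_algebra G A" "f2 \<in> generated_algebra G A"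
  shows "(\<lambda>g. f1 g - f2 g) \<in> generated_algebra G A"
  using generated_algebra.add[OF assms(1) generated_algebra.scale[OF assms(2), of "-1"]]
  by (simp add: algebra_simps)

lemma generated_algebra_least:
  assumes "A \<subseteq> generated_algebra G B"
  shows "generated_algebra G A \<subseteq> generated_algebra G B"
proof
  fix f assume "f \<in> generated_algebra G A"
  then show "f \<in> generated_algebra G B"
  proof induction
    case (generator f)
    then show ?case using assms by blast
  next
    case zero
    show ?case by (rule generated_algebra.zero)
  next
    case (add f1 f2)
    show ?case using add.IH by (rule generated_algebra.add)
  next
    case (scale f c)
    show ?case using scale.IH by (rule generated_algebra.scale)
  next
    case (conv f1 f2)
    show ?case using conv.IH by (rule generated_algebra.conv)
  qed
qed

context groupoid
begin

lemma generated_algebra_indicator_set_mul: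
  assumes "(indicator E :: 'a \<Rightarrow> 'k::field) \<in> generated_algebra G A"
    and "(indicator F :: 'a \<Rightarrow> 'k) \<in> generated_algebra G A"
    and "F \<subseteq> arrows G" "inj_on (orig G) F"
  shows "(indicator (set_mul G E F) :: 'a \<Rightarrow> 'k) \<in> generated_algebra G A"
  using generated_algebra.conv[OF assms(1,2)] by (simp add: convolution_indicator[OF assms(3,4)])

text \<open>The set in the conclusion is \<open>F W\<close>.\<close>

lemma generated_algebra_indicator_restrict:
  assumes "(indicator F :: 'a \<Rightarrow> 'k::field) \<in> generated_algebra G A"
    and "(indicator W :: 'a \<Rightarrow> 'k) \<in> generated_algebra G A"
    and "F \<subseteq> arrows G" "W \<subseteq> units G"
  shows "(indicator {g \<in> F. orig G g \<in> W} :: 'a \<Rightarrow> 'k) \<in> generated_algebra G A"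
proof -
  have "inj_on (orig G) W" using assms(4) by (auto simp: inj_on_def orig_unit subset_iff)
  then show ?thesis
    using generated_algebra_indicator_set_mul[OF assms(1,2)] assms(3,4) units_subset_arrows
    by (simp add: set_mul_units_right)
qed

lemma generated_algebra_indicator_Int:
  assumes "(indicator V :: 'a \<Rightarrow> 'k::field) \<in> generated_algebra G A"
    and "(indicator W :: 'a \<Rightarrow> 'k) \<in> generated_algebra G A"
    and "V \<subseteq> units G" "W \<subseteq> units G"
  shows "(indicator (V \<inter> W) :: 'a \<Rightarrow> 'k) \<in> generated_algebra G A"
proof -
  have "V \<subseteq> arrows G" "{g \<in> V. orig G g \<in> W} = V \<inter> W"
    using assms(3) units_subset_arrows by (auto simp: orig_unit subset_iff)
  then show ?thesis
    using generated_algebra_indicator_restrict[OF assms(1,2)] assms(4) by simp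
qed

lemma generated_algebra_indicator_Diff:
  assumes "(indicator V :: 'a \<Rightarrow> 'k::field) \<in> generated_algebra G A"
    and "(indicator W :: 'a \<Rightarrow> 'k) \<in> generated_algebra G A" and "W \<subseteq> V"
  shows "(indicator (V - W) :: 'a \<Rightarrow> 'k) \<in> generated_algebra G A"
proof -
  have "(indicator (V - W) :: 'a \<Rightarrow> 'k) = (\<lambda>g. indicator V g - indicator W g)"
    using assms(3) by (auto simp: fun_eq_iff indicator_def)
  then show ?thesis using generated_algebra_diff[OF assms(1,2)] by simp
qed

text \<open>Inclusion-exclusion: the indicator of the overlap is the first indicator times \<open>1\<^sub>W\<close>.\<close>

lemma generated_algebra_indicator_restrict_Un:
  assumes "(indicator {g \<in> F. orig G g \<in> V} :: 'a \<Rightarrow> 'k::field) \<in> generated_algebra G A"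
    and "(indicator {g \<in> F. orig G g \<in> W} :: 'a \<Rightarrow> 'k) \<in> generated_algebra G A"
    and "(indicator W :: 'a \<Rightarrow> 'k) \<in> generated_algebra G A"
    and "F \<subseteq> arrows G" "W \<subseteq> units G"
  shows "(indicator {g \<in> F. orig G g \<in> V \<union> W} :: 'a \<Rightarrow> 'k) \<in> generated_algebra G A"
proof -
  have "(indicator {g \<in> {g \<in> F. orig G g \<in> V}. orig G g \<in> W} :: 'a \<Rightarrow> 'k) \<in> generated_algebra G A"
    using assms(4,5) by (intro generated_algebra_indicator_restrict[OF assms(1,3)]) auto
  from generated_algebra_diff[OF generated_algebra.add[OF assms(1,2)] this]
  show ?thesis
    by (rule back_subst[of "\<lambda>f. f \<in> generated_algebra G A"]) (auto simp: fun_eq_iff indicator_def)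
qed

end

section \<open>The algebra of a generating expansive family\<close>

lemma finite_family_power: "finite S \<Longrightarrow> finite (family_power G S n)"
proof (induction n)
  case (Suc n)
  have "family_power G S (Suc n) = (\<lambda>(A, B). set_mul G A B) ` (S \<times> family_power G S n)"
    by auto
  then show ?case using Suc by simp
qed simp

lemma itinerary_set_eq_Inter:
  "itinerary_set G S x n = units G \<inter>
     (\<Inter>F\<in>family_power G S n. if x \<in> orig G ` F then orig G ` F else units G - orig G ` F)"
proof -
  have "(U \<inter> \<Inter>{D F | F. F \<in> \<F> \<and> x \<in> D F}) - \<Union>{D F | F. F \<in> \<F> \<and> x \<notin> D F}
      = U \<inter> (\<Inter>F\<in>\<F>. if x \<in> D F then D F else U - D F)"
    for U and D :: "'a set \<Rightarrow> 'a set" and \<F>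
    by (auto split: if_splits)
  then show ?thesis unfolding itinerary_set_def .
qed

lemma mem_itinerary_set: "x \<in> units G \<Longrightarrow> x \<in> itinerary_set G S x n"
  by (auto simp: itinerary_set_def)

text \<open>The indicator of \<open>F\<^sup>-\<^sup>1\<close> is the partial inverse of the indicator of \<open>F\<close>. Asking for it
  as well makes the family closed under inversion, and yields the idempotent
  \<open>1\<^bsub>o(F)\<^esub> = 1\<^bsub>F\<^sup>-\<^sup>1\<^esub> * 1\<^sub>F\<close>.\<close>

definition invertible_bisections :: "'a tgroupoid \<Rightarrow> ('a \<Rightarrow> 'k::field) set \<Rightarrow> 'a set set"
  where "invertible_bisections G A = {F. open_compact_bisection G F \<and>
    (indicator F :: 'a \<Rightarrow> 'k) \<in> generated_algebra G A \<and>
    (indicator (ginv G ` F) :: 'a \<Rightarrow> 'k) \<in> generated_algebra G A}"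

definition clopen_idempotents :: "'a tgroupoid \<Rightarrow> ('a \<Rightarrow> 'k::field) set \<Rightarrow> 'a set set"
  where "clopen_idempotents G A = {W. openin (unit_space G) W \<and> closedin (unit_space G) W \<and>
    (indicator W :: 'a \<Rightarrow> 'k) \<in> generated_algebra G A}"

context etale_groupoid
begin

lemma invertible_bisections_set_mul:
  fixes A :: "('a \<Rightarrow> 'k::field) set"
  assumes "Hausdorff_space (unit_space G)"
    and E: "E \<in> invertible_bisections G A" and F: "F \<in> invertible_bisections G A"
  shows "set_mul G E F \<in> invertible_bisections G A"
proof -
  have ocb: "open_compact_bisection G E" "open_compact_bisection G F"
    using E F by (auto simp: invertible_bisections_def)
  note sub = this[THEN open_compact_bisection_subset]
  note ocb' = ocb[THEN open_compact_bisection_inv_image]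
  have "(indicator (set_mul G E F) :: 'a \<Rightarrow> 'k) \<in> generated_algebra G A"
    using E F ocb sub
    by (intro generated_algebra_indicator_set_mul)
       (auto simp: invertible_bisections_def open_compact_bisection_iff)
  moreover have "(indicator (ginv G ` set_mul G E F) :: 'a \<Rightarrow> 'k) \<in> generated_algebra G A"
    unfolding inv_image_set_mul[OF sub]
    using E F ocb' inv_image_subset_arrows[OF sub(1)]
    by (intro generated_algebra_indicator_set_mul)
       (auto simp: invertible_bisections_def open_compact_bisection_iff)
  ultimately show ?thesis
    using open_compact_bisection_set_mul[OF assms(1) ocb] by (simp add: invertible_bisections_def)
qed

lemma invertible_bisections_inv_image:
  assumes "F \<in> invertible_bisections G A"
  shows "ginv G ` F \<in> invertible_bisections G A"
proof -
  have ocb: "open_compact_bisection G F" using assms by (simp add: invertible_bisections_def)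
  show ?thesis
    using assms open_compact_bisection_inv_image[OF ocb]
    unfolding invertible_bisections_def
    by (simp only: mem_Collect_eq inv_image_inv_image[OF open_compact_bisection_subset[OF ocb]])
qed

lemma clopen_idempotents_orig_image:
  fixes A :: "('a \<Rightarrow> 'k::field) set"
  assumes "Hausdorff_space (unit_space G)" and F: "F \<in> invertible_bisections G A"
  shows "orig G ` F \<in> clopen_idempotents G A"
proof -
  have ocb: "open_compact_bisection G F" using F by (simp add: invertible_bisections_def)
  note sub = open_compact_bisection_subset[OF ocb]
  have "(indicator (set_mul G (ginv G ` F) F) :: 'a \<Rightarrow> 'k) \<in> generated_algebra G A"
    using F ocb sub
    by (intro generated_algebra_indicator_set_mul)
       (auto simp: invertible_bisections_def open_compact_bisection_iff)
  then show ?thesis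
    using set_mul_inv_image[OF sub] ocb clopen_orig_image[OF assms(1) ocb]
    by (simp add: clopen_idempotents_def open_compact_bisection_iff)
qed

lemma units_clopen_idempotents:
  assumes "Hausdorff_space (unit_space G)" "units G \<in> invertible_bisections G A"
  shows "units G \<in> clopen_idempotents G A"
proof -
  have "orig G ` units G = units G" by (simp add: orig_unit)
  then show ?thesis using clopen_idempotents_orig_image[OF assms] by simp
qed

lemma clopen_idempotents_subset_units: "W \<in> clopen_idempotents G A \<Longrightarrow> W \<subseteq> units G"
  using openin_subset[of "unit_space G" W] by (simp add: clopen_idempotents_def topspace_unit_space)

lemma clopen_idempotents_Int:
  assumes "V \<in> clopen_idempotents G A" "W \<in> clopen_idempotents G A"
  shows "V \<inter> W \<in> clopen_idempotents G A"
  using assms assms[THEN clopen_idempotents_subset_units]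
  by (simp add: clopen_idempotents_def generated_algebra_indicator_Int openin_Int closedin_Int)

lemma clopen_idempotents_Diff:
  assumes "units G \<in> clopen_idempotents G A" "W \<in> clopen_idempotents G A"
  shows "units G - W \<in> clopen_idempotents G A"
  using assms clopen_idempotents_subset_units[OF assms(2)]
  by (simp add: clopen_idempotents_def generated_algebra_indicator_Diff openin_diff closedin_diff)

lemma family_power_invertible_bisections:
  assumes "Hausdorff_space (unit_space G)"
    and "units G \<in> invertible_bisections G A" "S \<subseteq> invertible_bisections G A"
  shows "family_power G S n \<subseteq> invertible_bisections G A"
proof (induction n)
  case 0
  then show ?case using assms(2) by simp
next
  case (Suc n)
  then show ?case using assms(1,3) by (auto intro: invertible_bisections_set_mul)
qed

text \<open>An itinerary set is a finite Boolean combination of domains of products.\<close>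

lemma itinerary_set_clopen_idempotents:
  assumes haus: "Hausdorff_space (unit_space G)"
    and units: "units G \<in> invertible_bisections G A"
    and S: "S \<subseteq> invertible_bisections G A" "finite S"
  shows "itinerary_set G S x n \<in> clopen_idempotents G A"
proof -
  have top: "units G \<in> clopen_idempotents G A"
    by (rule units_clopen_idempotents[OF haus units])
  let ?C = "\<lambda>F. if x \<in> orig G ` F then orig G ` F else units G - orig G ` F"
  have C: "?C F \<in> clopen_idempotents G A" if "F \<in> family_power G S n" for F
  proof -
    have "orig G ` F \<in> clopen_idempotents G A"
      using that family_power_invertible_bisections[OF haus units S(1)]
      by (intro clopen_idempotents_orig_image[OF haus]) blast
    then show ?thesis using clopen_idempotents_Diff[OF top] by simp
  qed
  have "units G \<inter> (\<Inter>F\<in>\<F>. ?C F) \<in> clopen_idempotents G A"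
    if "finite \<F>" "\<F> \<subseteq> family_power G S n" for \<F>
    using that
  proof (induction \<F>)
    case empty
    then show ?case using top by simp
  next
    case (insert F \<F>)
    then have "?C F \<in> clopen_idempotents G A"
        "units G \<inter> (\<Inter>F\<in>\<F>. ?C F) \<in> clopen_idempotents G A"
      using C by blast+
    from clopen_idempotents_Int[OF this] show ?case
      unfolding INT_insert by (simp only: Int_left_commute)
  qed
  then show ?thesis
    unfolding itinerary_set_eq_Inter using finite_family_power[OF S(2)] by blast
qed

lemma expansive_clopen_idempotents_basis:
  assumes haus: "Hausdorff_space (unit_space G)" and comp: "compact_space (unit_space G)"
    and units: "units G \<in> invertible_bisections G A"
    and S: "S \<subseteq> invertible_bisections G A" "finite S" "expansive G S"
    and U: "openin (unit_space G) U" "x \<in> U"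
  shows "\<exists>W\<in>clopen_idempotents G A. x \<in> W \<and> W \<subseteq> U"
proof (rule separating_open_sets_form_basis[OF comp _ _ _ _ U])
  show "openin (unit_space G) V" if "V \<in> clopen_idempotents G A" for V
    using that by (simp add: clopen_idempotents_def)
  show "topspace (unit_space G) \<in> clopen_idempotents G A"
    unfolding topspace_unit_space by (rule units_clopen_idempotents[OF haus units])
  show "V \<inter> W \<in> clopen_idempotents G A"
    if "V \<in> clopen_idempotents G A" "W \<in> clopen_idempotents G A" for V W
    using that by (rule clopen_idempotents_Int)
  show "\<exists>V\<in>clopen_idempotents G A. \<exists>W\<in>clopen_idempotents G A. x \<in> V \<and> y \<in> W \<and> V \<inter> W = {}"
    if xy: "x \<in> topspace (unit_space G)" "y \<in> topspace (unit_space G)" "x \<noteq> y" for x y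
  proof -
    have units_xy: "x \<in> units G" "y \<in> units G" using xy by (simp_all add: topspace_unit_space)
    then obtain n where "itinerary_set G S x n \<inter> itinerary_set G S y n = {}"
      using S(3) xy(3) unfolding expansive_def by blast
    then show ?thesis
      by (intro bexI[of _ "itinerary_set G S x n"] bexI[of _ "itinerary_set G S y n"] conjI
          mem_itinerary_set units_xy itinerary_set_clopen_idempotents[OF haus units S(1,2)])
  qed
qed

lemma generates_arrow_in_invertible_bisection:
  assumes haus: "Hausdorff_space (unit_space G)"
    and units: "units G \<in> invertible_bisections G A"
    and S: "S \<subseteq> invertible_bisections G A" "generates G S" and g: "g \<in> arrows G"
  shows "\<exists>P\<in>invertible_bisections G A. g \<in> P"
proof -
  have "\<exists>P\<in>invertible_bisections G A. g \<in> P"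
    if "g \<in> set_power G (\<Union>S \<union> ginv G ` \<Union>S) n" for g n
    using that
  proof (induction n arbitrary: g)
    case 0
    then show ?case using units by auto
  next
    case (Suc n)
    have "g \<in> {gmul G a b | a b. a \<in> \<Union>S \<union> ginv G ` \<Union>S
        \<and> b \<in> set_power G (\<Union>S \<union> ginv G ` \<Union>S) n \<and> (a, b) \<in> composable G}"
      using Suc.prems unfolding set_power.simps set_mul_def .
    then obtain a b where ab: "a \<in> \<Union>S \<union> ginv G ` \<Union>S" "(a, b) \<in> composable G" "g = gmul G a b"
        "b \<in> set_power G (\<Union>S \<union> ginv G ` \<Union>S) n"
      unfolding mem_Collect_eq by (elim exE conjE)
    obtain P where P: "P \<in> invertible_bisections G A" "b \<in> P" using Suc.IH[OF ab(4)] by blast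
    obtain E where E: "E \<in> S" "a \<in> E \<or> a \<in> ginv G ` E" using ab(1) by blast
    then have "E \<in> invertible_bisections G A" "ginv G ` E \<in> invertible_bisections G A"
      using S(1) invertible_bisections_inv_image[of E A] by auto
    then obtain F where F: "F \<in> invertible_bisections G A" "a \<in> F" using E(2) by blast
    have "g \<in> set_mul G F P" using ab P F by (auto simp: set_mul_def)
    then show ?case using invertible_bisections_set_mul[OF haus F(1) P(1)] by (intro bexI)
  qed
  then show ?thesis using g S(2) by (auto simp: generates_def)
qed

text \<open>The sets \<open>W\<close> in \<open>?T\<close> are those above which \<open>F\<close> is already known to be represented in the
  algebra. They cover \<open>o(F)\<close> and are closed under unions, so by compactness \<open>o(F)\<close> is one of them.\<close>

lemma indicator_in_generated_algebra:
  fixes A :: "('a \<Rightarrow> 'k::field) set"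
  assumes haus: "Hausdorff_space (unit_space G)" and comp: "compact_space (unit_space G)"
    and units: "units G \<in> invertible_bisections G A"
    and S: "S \<subseteq> invertible_bisections G A" "finite S" "expansive G S" "generates G S"
    and F: "open_compact_bisection G F"
  shows "(indicator F :: 'a \<Rightarrow> 'k) \<in> generated_algebra G A"
proof -
  let ?T = "{W \<in> clopen_idempotents G A. W \<subseteq> orig G ` F \<and>
    (indicator {g \<in> F. orig G g \<in> W} :: 'a \<Rightarrow> 'k) \<in> generated_algebra G A}"
  note sub = open_compact_bisection_subset[OF F]
  have open_F: "openin (gtop G) F" and inj_F: "inj_on (orig G) F"
    using F by (auto simp: open_compact_bisection_iff)
  have "orig G ` F \<in> ?T"
  proof (rule compactin_mem_union_closed_cover)
    show "compactin (unit_space G) (orig G ` F)"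
      using F image_compactin[OF _ continuous_orig] by (auto simp: open_compact_bisection_def)
    show "openin (unit_space G) W \<and> W \<subseteq> orig G ` F" if "W \<in> ?T" for W
      using that by (auto simp: clopen_idempotents_def)
    show "{} \<in> ?T"
      using generated_algebra.zero[of G A] by (simp add: clopen_idempotents_def indicator_def[abs_def])
    show "V \<union> W \<in> ?T" if V: "V \<in> ?T" and W: "W \<in> ?T" for V W
    proof -
      have VW: "V \<subseteq> units G" "W \<subseteq> units G"
        using V W clopen_idempotents_subset_units by auto
      \<comment> \<open>Sets of units are the case \<open>F = units G\<close> of the union lemma.\<close>
      have "{g \<in> units G. orig G g \<in> X} = X" if "X \<subseteq> units G" for X
        using that by (auto simp: orig_unit)
      from this[of V] this[of W] this[of "V \<union> W"]
      have "(indicator (V \<union> W) :: 'a \<Rightarrow> 'k) \<in> generated_algebra G A"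
        using generated_algebra_indicator_restrict_Un[of "units G" V A W] V W VW units_subset_arrows
        by (simp add: clopen_idempotents_def)
      moreover have "(indicator {g \<in> F. orig G g \<in> V \<union> W} :: 'a \<Rightarrow> 'k) \<in> generated_algebra G A"
        using V W VW sub by (intro generated_algebra_indicator_restrict_Un) (auto simp: clopen_idempotents_def)
      ultimately show ?thesis using V W by (auto simp: clopen_idempotents_def)
    qed
    show "\<exists>W\<in>?T. x \<in> W" if x: "x \<in> orig G ` F" for x
    proof -
      obtain g where g: "g \<in> F" "x = orig G g" using x by blast
      obtain P where P: "P \<in> invertible_bisections G A" "g \<in> P"
        using generates_arrow_in_invertible_bisection[OF haus units S(1,4)] g sub by blast
      have P_ocb: "open_compact_bisection G P" using P by (simp add: invertible_bisections_def)
      have inj_P: "inj_on (orig G) P" using P_ocb by (simp add: open_compact_bisection_iff)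
      have "openin (unit_space G) (orig G ` (F \<inter> P))"
        using open_orig open_F P_ocb by (auto simp: open_map_def open_compact_bisection_def)
      moreover have "x \<in> orig G ` (F \<inter> P)" using g P by blast
      ultimately obtain W where W: "W \<in> clopen_idempotents G A" "x \<in> W" "W \<subseteq> orig G ` (F \<inter> P)"
        using expansive_clopen_idempotents_basis[OF haus comp units S(1-3)] by blast
      \<comment> \<open>Above \<open>W\<close> both bisections consist of the arrows of \<open>F \<inter> P\<close>.\<close>
      have "h \<in> F \<longleftrightarrow> h \<in> P" if h: "orig G h \<in> W" for h
      proof -
        obtain p where "p \<in> F" "p \<in> P" "orig G h = orig G p" using h W(3) by auto
        then show ?thesis using inj_F inj_P by (metis inj_onD)
      qed
      then have "{g \<in> F. orig G g \<in> W} = {g \<in> P. orig G g \<in> W}" by blast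
      moreover have "(indicator {g \<in> P. orig G g \<in> W} :: 'a \<Rightarrow> 'k) \<in> generated_algebra G A"
        using P W(1) open_compact_bisection_subset[OF P_ocb] clopen_idempotents_subset_units[OF W(1)]
        by (intro generated_algebra_indicator_restrict)
           (auto simp: invertible_bisections_def clopen_idempotents_def)
      moreover have "W \<subseteq> orig G ` F" using W(3) by blast
      ultimately show ?thesis using W(1,2) by (intro bexI[of _ W]) auto
    qed
  qed
  moreover have "{g \<in> F. orig G g \<in> orig G ` F} = F" by blast
  ultimately show ?thesis by simp
qed

end

theorem proposition4p4:
  fixes G :: "'a tgroupoid" and S :: "'a set set"
  assumes "etale_groupoid G"
    and "compact_space (unit_space G)"
    and "totally_disconnected_space (unit_space G)"
    and "metrizable_space (unit_space G)"
    and "finite S"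
    and "\<And>F. F \<in> S \<Longrightarrow> open_compact_bisection G F"
    and "generates G S"
    and "expansive G S"
  shows "generated_unital_algebra G {indicator F | F. F \<in> S \<union> (\<lambda>F. ginv G ` F) ` S}
    = (groupoid_algebra G :: ('a \<Rightarrow> 'k::field) set)"
proof -
  interpret etale_groupoid G by (rule assms(1))
  define A where "A = insert (indicator (units G))
    {indicator F :: 'a \<Rightarrow> 'k | F. F \<in> S \<union> (\<lambda>F. ginv G ` F) ` S}"
  define B where "B = {indicator F :: 'a \<Rightarrow> 'k | F. open_compact_bisection G F}"
  have haus: "Hausdorff_space (unit_space G)"
    using assms(4) by (rule metrizable_imp_Hausdorff_space)
  note ocb_units = open_compact_bisection_units[OF assms(2)]
  have A_gen: "indicator (units G) \<in> generated_algebra G A"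
      "F \<in> S \<Longrightarrow> indicator F \<in> generated_algebra G A"
      "F \<in> S \<Longrightarrow> indicator (ginv G ` F) \<in> generated_algebra G A" for F
    unfolding A_def by (rule generated_algebra.generator, blast)+
  have "A \<subseteq> generated_algebra G B"
  proof
    fix f assume "f \<in> A"
    then obtain F where "f = indicator F" "F = units G \<or> F \<in> S \<or> F \<in> (\<lambda>F. ginv G ` F) ` S"
      unfolding A_def by blast
    moreover from this have "open_compact_bisection G F"
      using ocb_units assms(6) open_compact_bisection_inv_image by blast
    ultimately show "f \<in> generated_algebra G B"
      unfolding B_def by (intro generated_algebra.generator) blast
  qed
  moreover have "B \<subseteq> generated_algebra G A"
  proof -
    have "units G \<in> invertible_bisections G A"
      using ocb_units A_gen(1) by (simp add: invertible_bisections_def inv_image_units)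
    moreover have "S \<subseteq> invertible_bisections G A"
      using assms(6) A_gen(2,3) by (simp add: invertible_bisections_def subset_iff)
    ultimately have "(indicator F :: 'a \<Rightarrow> 'k) \<in> generated_algebra G A"
      if "open_compact_bisection G F" for F
      using that by (intro indicator_in_generated_algebra[OF haus assms(2) _ _ assms(5,8,7)])
    then show ?thesis unfolding B_def by blast
  qed
  ultimately have "generated_algebra G A = generated_algebra G B"
    by (intro equalityI generated_algebra_least)
  then show ?thesis
    unfolding generated_unital_algebra_def groupoid_algebra_def A_def B_def .
qed

end
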